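(* For all integers $n\geq 0$ we have $$H_n\big((2k+3)B_{2k+2}\big)=\frac{1}{2^{n+1}}\prod_{\ell=1}^n\left(\frac{\ell^{3}(\ell+1)^{3}}{4(2\ell+1)^{2}}\right)^{n+1-\ell}.$$
   Context: The Bernoulli numbers $B_k$ are defined by $\frac{t}{e^t-1}=\sum_{k\ge 0}B_k\frac{t^k}{k!}$. For a sequence $(c_0,c_1,\ldots)$ (indexed from $k=0$), $H_n(c_k)=\det\big(c_{i+j}\big)_{0\le i,j\le n}$; here $c_k=(2k+3)B_{2k+2}$. Empty products equal $1$. *)

theory Defs
  imports
    Jordan_Normal_Form.Determinant
    "HOL-Computational_Algebra.Formal_Power_Series"
begin

text \<open>
  Both power series in the quotient have subdegree 1, so the division is exact:
  the quotient times the denominator gives back \<^term>\<open>fps_X\<close>.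
  In this convention the first Bernoulli number is $-1/2$.
\<close>
definition bernoulli :: "nat \<Rightarrow> real" where
  "bernoulli k = fact k * fps_nth (fps_X / (fps_exp 1 - 1)) k"

text \<open>The index is the largest row index, so \<open>hankel_det n c\<close> has order \<open>n + 1\<close>.\<close>
definition hankel_det :: "nat \<Rightarrow> (nat \<Rightarrow> 'a :: comm_ring_1) \<Rightarrow> 'a" where
  "hankel_det n c = det (mat (n + 1) (n + 1) (\<lambda>(i, j). c (i + j)))"

end

theory Submission
  imports Defs
begin

text \<open>
  Let $L$ be the linear functional with $L(y^k) = (2k+3) B_{2k+2}$, and let
  $\phi_k(y) = \prod_{j=1}^k (j^2 - y)$. The sequence is the moment sequence of the Wilson
  polynomials with parameters $(0,1,1,1)$, which suggests
  $L(\phi_k \phi_m) = (k+1)!\,k!\,(m+1)!\,m!/(k+m+2)$. For $m = 0$ this follows from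
  $L(q) = E((t^3 q(t^2))')$, where $E(t^m) = B_m$, and $E(p(t+1) - p(t)) = p'(0)$:
  the polynomial $t^3 \phi_k(t^2)$ is an explicit forward difference. The general case is an
  induction on $m$. As $\phi_k$ has leading coefficient $\pm 1$, the Hankel determinant is
  the determinant of the matrix $L(\phi_i \phi_j)$, whose $LDL^T$ factorization is a
  telescoping sum.
\<close>

section \<open>Determinants of congruent and of diagonal matrices\<close>

lemma det_lower_congruence:
  fixes A P :: "nat \<Rightarrow> nat \<Rightarrow> 'a :: comm_ring_1"
  assumes "\<And>i j. i < j \<Longrightarrow> P i j = 0"
  shows "det (mat m m (\<lambda>(i, j). \<Sum>k<m. \<Sum>l<m. P i k * A k l * P j l)) =
    (\<Prod>k<m. P k k)\<^sup>2 * det (mat m m (\<lambda>(i, j). A i j))"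
proof -
  define L where "L = mat m m (\<lambda>(i, j). P i j)"
  define M where "M = mat m m (\<lambda>(i, j). A i j)"
  have carrier [simp]: "L \<in> carrier_mat m m" "M \<in> carrier_mat m m"
    by (auto simp: L_def M_def)
  have "mat m m (\<lambda>(i, j). \<Sum>k<m. \<Sum>l<m. P i k * A k l * P j l) = L * M * L\<^sup>T"
  proof (rule eq_matI)
    fix i j assume "i < dim_row (L * M * L\<^sup>T)" "j < dim_col (L * M * L\<^sup>T)"
    hence ij: "i < m" "j < m" by (auto simp: L_def)
    have "(L * M * L\<^sup>T) $$ (i, j) = (\<Sum>l<m. (\<Sum>k<m. P i k * A k l) * P j l)"
      using ij by (simp add: L_def M_def scalar_prod_def atLeast0LessThan)
    also have "\<dots> = (\<Sum>k<m. \<Sum>l<m. P i k * A k l * P j l)"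
      by (simp add: sum_distrib_right) (rule sum.swap)
    finally show "mat m m (\<lambda>(i, j). \<Sum>k<m. \<Sum>l<m. P i k * A k l * P j l) $$ (i, j) =
        (L * M * L\<^sup>T) $$ (i, j)"
      using ij by simp
  qed (auto simp: L_def)
  moreover have "det (L * M * L\<^sup>T) = (det L)\<^sup>2 * det M"
    using det_mult[of "L * M" m "L\<^sup>T"] det_mult[of L m M] det_transpose[of L m]
      mult_carrier_mat[of L m m M m]
    by (simp add: power2_eq_square mult_ac)
  moreover have "det L = (\<Prod>k<m. P k k)"
  proof -
    have "det L = prod_list (diag_mat L)"
      by (rule det_lower_triangular[where n = m]) (auto simp: L_def assms)
    also have "\<dots> = (\<Prod>k<m. P k k)"
      by (simp add: prod_list_diag_prod L_def atLeast0LessThan)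
    finally show ?thesis .
  qed
  ultimately show ?thesis by (simp add: M_def)
qed

lemma det_diagonal:
  fixes d :: "nat \<Rightarrow> 'a :: comm_ring_1"
  shows "det (mat m m (\<lambda>(i, j). if i = j then d i else 0)) = (\<Prod>k<m. d k)"
  by (subst det_lower_triangular[where n = m])
    (auto simp: prod_list_diag_prod atLeast0LessThan)

section \<open>Linear functionals on polynomials, given by their moments\<close>

definition moment :: "(nat \<Rightarrow> 'a) \<Rightarrow> 'a poly \<Rightarrow> 'a :: comm_ring_1" where
  "moment c p = (\<Sum>i\<le>degree p. coeff p i * c i)"

lemma moment_eq:
  assumes "degree p \<le> N"
  shows "moment c p = (\<Sum>i\<le>N. coeff p i * c i)"
  unfolding moment_def using assms
  by (intro sum.mono_neutral_left) (auto simp: coeff_eq_0)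

lemma moment_add: "moment c (p + q) = moment c p + moment c q"
proof -
  define N where "N = max (degree p) (degree q)"
  have "degree (p + q) \<le> N" "degree p \<le> N" "degree q \<le> N"
    by (auto simp: N_def degree_add_le)
  thus ?thesis by (simp add: moment_eq sum.distrib algebra_simps)
qed

lemma moment_monom [simp]: "moment c (monom a n) = a * c n"
  by (subst moment_eq[of _ n])
    (auto simp: degree_monom_le if_distrib[of "\<lambda>x. x * _"] cong: if_cong)

lemma moment_smult: "moment c (smult a p) = a * moment c p"
  by (subst moment_eq[of _ "degree p"])
    (auto simp: moment_def degree_smult_le sum_distrib_left mult_ac)

lemma moment_diff: "moment c (p - q) = moment c p - moment c q"
  using moment_add[of c "p - q" q] by simp

text \<open>The terms \<open>monom a n\<close> carry their coefficients, so additivity alone reduces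
  an identity to monomials.\<close>

lemma additive_poly_eqI:
  fixes f g :: "'a :: comm_ring_1 poly \<Rightarrow> 'b :: ab_group_add"
  assumes f: "\<And>p q. f (p + q) = f p + f q" and g: "\<And>p q. g (p + q) = g p + g q"
    and monom: "\<And>a n. f (monom a n) = g (monom a n)"
  shows "f p = g p"
proof -
  have "f 0 = 0" "g 0 = 0" using f[of 0 0] g[of 0 0] by simp_all
  hence "f (\<Sum>i\<in>A. monom (coeff p i) i) = g (\<Sum>i\<in>A. monom (coeff p i) i)" for A
    by (induction A rule: infinite_finite_induct) (simp_all add: f g monom)
  from this[of "{..degree p}"] show ?thesis by (simp add: poly_as_sum_of_monoms)
qed

text \<open>A common degree bound n presents the Gram matrix of polynomials as a congruence of the
  Hankel matrix, in the form that \<open>det_lower_congruence\<close> takes.\<close>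

lemma moment_mult:
  assumes "degree p \<le> n" "degree q \<le> n"
  shows "moment c (p * q) = (\<Sum>i\<le>n. \<Sum>j\<le>n. coeff p i * c (i + j) * coeff q j)"
proof -
  have sum: "moment c (\<Sum>i\<in>A. f i) = (\<Sum>i\<in>A. moment c (f i))" if "finite A"
    for f :: "nat \<Rightarrow> 'a poly" and A
    using that by induction (simp_all add: moment_add, simp add: moment_def)
  have "p * q = (\<Sum>i\<le>n. monom (coeff p i) i) * (\<Sum>j\<le>n. monom (coeff q j) j)"
    using assms by (simp add: poly_as_sum_of_monoms')
  thus ?thesis by (simp add: sum_product sum mult_monom mult_ac)
qed

section \<open>The Bernoulli functional E and its difference rule\<close>

lemma bernoulli_binomial_sum:
  "(\<Sum>i\<le>m. real (m choose i) * bernoulli i) = bernoulli m + (if m = 1 then 1 else 0)"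
proof -
  define F :: "real fps" where "F = fps_X / (fps_exp 1 - 1)"
  have "subdegree (fps_exp 1 - 1 :: real fps) = 1"
    by (rule subdegreeI) auto
  hence "(fps_exp 1 - 1 :: real fps) dvd fps_X"
    by (subst fps_dvd_iff) auto
  hence "F * (fps_exp 1 - 1) = fps_X"
    unfolding F_def by (rule dvd_div_mult_self)
  \<comment> \<open>Comparing coefficients here gives the binomial recurrence; \<open>fps_X\<close>
    accounts for the exception at m = 1.\<close>
  hence "F * fps_exp 1 = F + fps_X" by (simp add: algebra_simps)
  hence "fps_nth (F * fps_exp 1) m = fps_nth (F + fps_X) m" by simp
  hence "fact m * (\<Sum>i\<le>m. fps_nth F i / fact (m - i)) =
      fact m * (fps_nth F m + (if m = 1 then 1 else 0))"
    by (simp add: fps_mult_nth atLeast0AtMost)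
  moreover have "fact m * (\<Sum>i\<le>m. fps_nth F i / fact (m - i)) =
      (\<Sum>i\<le>m. real (m choose i) * bernoulli i)"
    unfolding sum_distrib_left
    by (intro sum.cong) (auto simp: bernoulli_def F_def binomial_fact)
  ultimately show ?thesis by (auto simp: bernoulli_def F_def algebra_simps)
qed

text \<open>On monomials this is the binomial recurrence. The term \<open>coeff p 1\<close> is
  p'(0), so E is known on every forward difference.\<close>

lemma moment_bernoulli_shift:
  "moment bernoulli (pcompose p [:1, 1:]) = moment bernoulli p + coeff p 1"
proof (rule additive_poly_eqI[where p = p])
  fix a :: real and n
  have eq: "pcompose (monom a n) [:1, 1:] = smult a ([:1, 1:] ^ n)"
    by (simp add: poly_eq_poly_eq_iff[symmetric] fun_eq_iff poly_pcompose poly_monom)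
  have "moment bernoulli ([:1, 1:] ^ n) = (\<Sum>i\<le>n. real (n choose i) * bernoulli i)"
    by (subst moment_eq[of _ n])
      (auto simp: coeff_linear_poly_power degree_linear_power intro!: sum.cong)
  thus "moment bernoulli (pcompose (monom a n) [:1, 1:]) =
      moment bernoulli (monom a n) + coeff (monom a n) 1"
    unfolding eq by (simp add: moment_smult bernoulli_binomial_sum distrib_left)
qed (simp_all add: moment_add pcompose_add)

section \<open>The polynomials phi_k and their Gram matrix\<close>

definition node_poly :: "nat \<Rightarrow> real poly" where
  "node_poly k = (\<Prod>j = 1..k. [:(real j)\<^sup>2, -1:])"

lemma node_poly_0 [simp]: "node_poly 0 = 1"
  by (simp add: node_poly_def)

lemma node_poly_Suc: "node_poly (Suc k) = [:(real k + 1)\<^sup>2, -1:] * node_poly k"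
  by (simp add: node_poly_def mult_ac add_ac)

lemma degree_node_poly: "degree (node_poly k) = k"
proof (induction k)
  case (Suc k)
  have "node_poly k \<noteq> 0" by (auto simp: node_poly_def)
  thus ?case using Suc by (simp add: node_poly_Suc degree_mult_eq del: mult_pCons_left)
qed simp

lemma lead_coeff_node_poly: "coeff (node_poly k) k = (-1) ^ k"
proof -
  have "lead_coeff (node_poly k) = (-1) ^ k"
    by (induction k) (simp_all add: node_poly_Suc lead_coeff_mult del: mult_pCons_left)
  thus ?thesis by (simp add: degree_node_poly)
qed

lemma poly_node_poly_0: "poly (node_poly k) 0 = (fact k)\<^sup>2"
  by (induction k) (simp_all add: node_poly_Suc algebra_simps power2_eq_square)

text \<open>Since j^2 - t^2 = (j - t)(j + t), the shift of t by 1 moves both windows of linear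
  factors by one place, and only the end factors change. Denominators are cleared.\<close>

lemma node_poly_shift:
  "poly (node_poly k) ((t + 1)\<^sup>2) * (t - real k) * (t + 1) =
   poly (node_poly k) (t\<^sup>2) * t * (t + real k + 1)"
proof (induction k)
  case (Suc k)
  have "poly (node_poly (Suc k)) ((t + 1)\<^sup>2) * (t - real (Suc k)) * (t + 1) =
     (poly (node_poly k) ((t + 1)\<^sup>2) * (t - real k) * (t + 1)) * (- (t + k + 2) * (t - real k - 1))"
    by (simp add: node_poly_Suc algebra_simps power2_eq_square)
  thus ?case unfolding Suc
    by (simp add: node_poly_Suc algebra_simps power2_eq_square)
qed (simp add: algebra_simps)

definition bernoulli_seq :: "nat \<Rightarrow> real" where
  "bernoulli_seq k = (2 * real k + 3) * bernoulli (2 * k + 2)"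

text \<open>The weight 2n + 3 comes from differentiating t^3 * t^(2n), which leaves t^(2n+2) for
  E.\<close>

lemma moment_bernoulli_seq:
  "moment bernoulli_seq p = moment bernoulli (pderiv (monom 1 3 * pcompose p [:0, 0, 1:]))"
proof (rule additive_poly_eqI[where p = p])
  fix a :: real and n
  have "pcompose (monom a n) [:0, 0, 1:] = monom a (2 * n)"
    by (simp add: poly_eq_poly_eq_iff[symmetric] fun_eq_iff poly_pcompose poly_monom power_mult
        power2_eq_square)
  thus "moment bernoulli_seq (monom a n) =
      moment bernoulli (pderiv (monom 1 3 * pcompose (monom a n) [:0, 0, 1:]))"
    by (simp add: mult_monom pderiv_monom bernoulli_seq_def eval_nat_numeral algebra_simps)
qed (simp_all add: moment_add pcompose_add pderiv_add algebra_simps)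

lemma moment_node_poly:
  "moment bernoulli_seq (node_poly k) = fact (Suc k) * fact k / (real k + 2)"
proof -
  define Z where "Z = pcompose (node_poly k) [:0, 0, 1:]"
  \<comment> \<open>The antidifference of $t^3 \phi_k(t^2)$; it has a double zero at $0$.\<close>
  define Q where "Q = smult (1 / (2 * (real k + 2))) 
    (monom 1 2 * ([:-1, 1:] * [:- (real k + 1), 1:] * Z))"
  have "pcompose Q [:1, 1:] - Q = monom 1 3 * Z"
  proof -
    have "poly (pcompose Q [:1, 1:] - Q) t = poly (monom 1 3 * Z) t" for t
    proof -
      \<comment> \<open>The shift turns (t - 1)(t - k - 1) into t (t - k), which supplies the factor
        t - k for \<open>node_poly_shift\<close>. Afterwards (t + 1)(t + k + 1) - (t - 1)(t - k - 1)
        = 2 (k + 2) t explains the normalization of Q.\<close>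
      have "2 * (real k + 2) * poly (pcompose Q [:1, 1:]) t =
          (t + 1) * t * (poly (node_poly k) ((t + 1)\<^sup>2) * (t - real k) * (t + 1))"
        by (simp add: Q_def Z_def poly_pcompose poly_monom power2_eq_square add_ac)
          (simp add: algebra_simps)
      also have "\<dots> = (t + 1) * t * (poly (node_poly k) (t\<^sup>2) * t * (t + real k + 1))"
        by (simp only: node_poly_shift)
      also have "\<dots> = 2 * (real k + 2) * (poly Q t + poly (monom 1 3 * Z) t)"
        by (simp add: Q_def Z_def poly_pcompose poly_monom power2_eq_square power3_eq_cube field_simps)
      finally show ?thesis by simp
    qed
    thus ?thesis by (simp add: poly_eq_poly_eq_iff[symmetric] fun_eq_iff del: poly_diff poly_mult)
  qed
  hence "moment bernoulli_seq (node_poly k) = moment bernoulli (pderiv (pcompose Q [:1, 1:] - Q))"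
    by (simp add: moment_bernoulli_seq Z_def)
  \<comment> \<open>The difference rule, applied to Q', gives Q''(0).\<close>
  also have "\<dots> = coeff (pderiv Q) 1"
    by (simp add: pderiv_diff pderiv_pcompose moment_diff moment_bernoulli_shift pderiv_pCons)
  also have "\<dots> = 2 * coeff Q 2"
    by (simp add: coeff_pderiv numeral_2_eq_2)
  \<comment> \<open>Q is t^2 times a polynomial, so this coefficient is the value of that polynomial
    at 0.\<close>
  also have "coeff Q 2 = (real k + 1) * poly Z 0 / (2 * (real k + 2))"
    by (simp add: Q_def coeff_monom_mult coeff_mult_0 poly_0_coeff_0 del: mult_pCons_left)
  also have "poly Z 0 = (fact k)\<^sup>2"
    by (simp add: Z_def poly_pcompose poly_node_poly_0)
  finally show ?thesis by (simp add: power2_eq_square field_simps)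
qed

lemma moment_node_poly_mult:
  "moment bernoulli_seq (node_poly k * node_poly m) =
    fact (Suc k) * fact k * fact (Suc m) * fact m / (real k + real m + 2)"
proof (induction m arbitrary: k)
  case 0
  thus ?case by (simp add: moment_node_poly)
next
  case (Suc m)
  \<comment> \<open>The new linear factors of phi_(k+1) and phi_(m+1) differ by a constant, so one
    factor can be moved from the second polynomial to the first. This raises k, hence the
    generalization over k.\<close>
  have "node_poly k * node_poly (Suc m) = node_poly (Suc k) * node_poly m +
      smult ((real m + 1)\<^sup>2 - (real k + 1)\<^sup>2) (node_poly k * node_poly m)"
    by (simp add: poly_eq_poly_eq_iff[symmetric] fun_eq_iff node_poly_Suc algebra_simps)
  hence "moment bernoulli_seq (node_poly k * node_poly (Suc m)) =
      fact (Suc (Suc k)) * fact (Suc k) * fact (Suc m) * fact m / (real k + real m + 3) +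
      ((real m + 1)\<^sup>2 - (real k + 1)\<^sup>2) *
      (fact (Suc k) * fact k * fact (Suc m) * fact m / (real k + real m + 2))"
    by (simp add: moment_add moment_smult Suc.IH add_ac)
  also have "\<dots> = fact (Suc k) * fact k * fact (Suc m) * fact m *
      ((real k + 1) * (real k + 2) / (real k + real m + 3) +
       ((real m + 1)\<^sup>2 - (real k + 1)\<^sup>2) / (real k + real m + 2))"
  proof -
    define W where "W = (fact (Suc k) * fact k * fact (Suc m) * fact m :: real)"
    have "fact (Suc (Suc k)) * fact (Suc k) * fact (Suc m) * fact m =
        W * ((real k + 1) * (real k + 2))"
      by (simp add: W_def mult_ac add_ac)
    thus ?thesis unfolding W_def[symmetric] by (simp add: distrib_left mult_ac)
  qed
  also have "((real m + 1)\<^sup>2 - (real k + 1)\<^sup>2) / (real k + real m + 2) = real m - real k"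
  proof -
    have "(real m + 1)\<^sup>2 - (real k + 1)\<^sup>2 = (real m - real k) * (real k + real m + 2)"
      by (simp add: algebra_simps power2_eq_square)
    moreover have "real k + real m + 2 \<noteq> 0" by linarith
    ultimately show ?thesis by simp
  qed
  also have "(real k + 1) * (real k + 2) / (real k + real m + 3) + (real m - real k) =
      (real m + 1) * (real m + 2) / (real k + real m + 3)"
  proof -
    have "real k + real m + 3 \<noteq> 0" by linarith
    thus ?thesis by (simp add: divide_simps) (simp add: algebra_simps)
  qed
  also have "fact (Suc k) * fact k * fact (Suc m) * fact m *
      ((real m + 1) * (real m + 2) / (real k + real m + 3)) =
      fact (Suc k) * fact k * fact (Suc (Suc m)) * fact (Suc m) / (real k + real (Suc m) + 2)"
    by (simp add: mult_ac add_ac)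
  finally show ?case .
qed

section \<open>The LDL^T factorization and its pivots\<close>

text \<open>
  From the expansion of $x^i$ in the polynomials orthogonal with respect to the weight $x$ on
  $[0,1]$, whose moment matrix is $1/(i+j+2)$.
\<close>
definition ldl_coeff :: "nat \<Rightarrow> nat \<Rightarrow> real" where
  "ldl_coeff i k = (if k \<le> i then (fact (Suc i) * fact i)\<^sup>2 / (fact (i - k) * fact (i + k + 2)) else 0)"

text \<open>The scaling of row i by (i+1)! i! is built into \<open>ldl_coeff\<close>, so the product
  gives the Gram entries themselves. The sum telescopes to T 0.\<close>

lemma ldl_coeff_sum:
  assumes "i < n" "j < n"
  shows "(\<Sum>k<n. ldl_coeff i k * (2 * real k + 2) * ldl_coeff j k) =
    fact (Suc i) * fact i * fact (Suc j) * fact j / (real i + real j + 2)"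
proof -
  \<comment> \<open>T k is a closed form for the sum of the terms from index k on; the
    \<open>if\<close> makes it vanish beyond the smaller of i and j, in particular at n.\<close>
  define T :: "nat \<Rightarrow> real" where
    "T k = (if k \<le> i \<and> k \<le> j
      then (fact (Suc i) * fact i)\<^sup>2 * (fact (Suc j) * fact j)\<^sup>2 /
        (fact (i - k) * fact (i + k + 1) * fact (j - k) * fact (j + k + 1) * (real i + real j + 2))
      else 0)" for k
  have "ldl_coeff i k * (2 * real k + 2) * ldl_coeff j k = T k - T (Suc k)" for k
  proof -
    define C where "C = (fact (Suc i) * fact i :: real)\<^sup>2 * (fact (Suc j) * fact j)\<^sup>2"
    consider "i < k \<or> j < k" | "k \<le> i" "k \<le> j" by linarith
    thus ?thesis
    proof cases
      case 2
      define a b where "a = i - k" and "b = j - k"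
      have ij: "i = a + k" "j = b + k" using 2 by (auto simp: a_def b_def)
      \<comment> \<open>Over the common denominator D the claim becomes (i + k + 2)(j + k + 2) - (i
        - k)(j - k) = (2k + 2)(i + j + 2).\<close>
      define D :: real where "D = fact a * fact (i + k + 2) * fact b * fact (j + k + 2) * (real i + real j + 2)"
      have D: "D \<noteq> 0" unfolding D_def by (simp add: add_nonneg_eq_0_iff)
      have "T k = C * (real i + k + 2) * (real j + k + 2) / D"
      proof -
        have "fact (i + k + 2) = (real i + k + 2) * fact (i + k + 1)"
          "fact (j + k + 2) = (real j + k + 2) * fact (j + k + 1)"
          by (simp_all add: add_ac)
        moreover have "real i + k + 2 \<noteq> 0" "real j + k + 2 \<noteq> 0" by linarith+
        ultimately have "C * (real i + k + 2) * (real j + k + 2) / D =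
            C / (fact a * fact (i + k + 1) * fact b * fact (j + k + 1) * (real i + real j + 2))"
          unfolding D_def by (simp add: divide_simps del: fact_Suc)
        thus ?thesis unfolding T_def C_def[symmetric] using 2 by (simp add: a_def b_def)
      qed
      \<comment> \<open>If k equals i or j, the left side is 0 by the \<open>if\<close> in T and the
        right side because a or b is 0.\<close>
      moreover have "T (Suc k) = C * real a * real b / D"
      proof (cases "a = 0 \<or> b = 0")
        case False
        then obtain a' b' where "a = Suc a'" "b = Suc b'" by (meson not0_implies_Suc)
        hence "T (Suc k) = C / (fact a' * fact (i + k + 2) * fact b' * fact (j + k + 2) * (real i + real j + 2))"
          unfolding T_def C_def[symmetric] by (simp add: ij)
        moreover have "fact a = real a * fact a'" "fact b = real b * fact b'"
          using \<open>a = Suc a'\<close> \<open>b = Suc b'\<close> by simp_all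
        ultimately show ?thesis unfolding D_def using False
          by (simp add: divide_simps del: fact_Suc)
      qed (auto simp: T_def ij)
      moreover have "ldl_coeff i k * (2 * real k + 2) * ldl_coeff j k =
          C * ((2 * real k + 2) * (real i + real j + 2)) / D"
        unfolding ldl_coeff_def D_def C_def using 2
        by (simp add: a_def b_def mult_ac)
      ultimately show ?thesis
        using D by (simp add: diff_divide_distrib[symmetric] ij algebra_simps)
    qed (auto simp: ldl_coeff_def T_def)
  qed
  hence "(\<Sum>k<n. ldl_coeff i k * (2 * real k + 2) * ldl_coeff j k) = T 0 - T n"
    by (simp add: sum_lessThan_telescope')
  also have "T n = 0" using assms by (simp add: T_def)
  finally show ?thesis
    by (simp add: T_def power2_eq_square)
qed

text \<open>The ratio of consecutive pivots is the factor with l = k + 1 in the final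
  product.\<close>

lemma ldl_coeff_diag_Suc:
  "(2 * real (Suc k) + 2) * (ldl_coeff (Suc k) (Suc k))\<^sup>2 =
    (2 * real k + 2) * (ldl_coeff k k)\<^sup>2 *
    (real (Suc k) ^ 3 * (real (Suc k) + 1) ^ 3 / (4 * (2 * real (Suc k) + 1) ^ 2))"
proof -
  define x where "x = real k"
  have x: "x + 2 \<noteq> 0" "2 * x + 3 \<noteq> 0" by (simp_all add: x_def add_nonneg_eq_0_iff)
  have "ldl_coeff (Suc k) (Suc k) = ldl_coeff k k * ((x + 1) * (x + 2))\<^sup>2 / ((2 * x + 3) * (2 * (x + 2)))"
    by (simp add: ldl_coeff_def x_def power2_eq_square field_simps)
  hence "(2 * real (Suc k) + 2) * (ldl_coeff (Suc k) (Suc k))\<^sup>2 =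
      2 * (x + 2) * (ldl_coeff k k * ((x + 1) * (x + 2))\<^sup>2 / ((2 * x + 3) * (2 * (x + 2))))\<^sup>2"
    by (simp add: x_def)
  also have "\<dots> = (2 * x + 2) * (ldl_coeff k k)\<^sup>2 * ((x + 1) ^ 3 * (x + 2) ^ 3 / (4 * (2 * x + 3)\<^sup>2))"
    using x by (simp add: divide_simps power_mult_distrib) (simp add: algebra_simps eval_nat_numeral)
  finally show ?thesis by (simp add: x_def add_ac)
qed

text \<open>The pivot at 0 is 2 * (1/2)^2 = 1/2; the n + 1 pivots together give the power of 2 in
  front of the result.\<close>

lemma ldl_coeff_diag:
  "(2 * real n + 2) * (ldl_coeff n n)\<^sup>2 =
    1 / 2 * (\<Prod>l = 1..n. real l ^ 3 * (real l + 1) ^ 3 / (4 * (2 * real l + 1) ^ 2))"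
proof (induction n)
  case 0
  show ?case by (simp add: ldl_coeff_def power2_eq_square)
next
  case (Suc n)
  show ?case unfolding ldl_coeff_diag_Suc Suc by simp
qed

text \<open>The factor f l occurs for k = l, ..., n, that is n + 1 - l times.\<close>

lemma prod_power_staircase:
  fixes f :: "nat \<Rightarrow> 'a :: comm_monoid_mult"
  shows "(\<Prod>k<Suc n. \<Prod>l = 1..k. f l) = (\<Prod>l = 1..n. f l ^ (n + 1 - l))"
proof (induction n)
  case (Suc n)
  have "(\<Prod>l = 1..n. f l ^ (Suc n + 1 - l)) = (\<Prod>l = 1..n. f l ^ (n + 1 - l)) * (\<Prod>l = 1..n. f l)"
    by (subst prod.distrib[symmetric], intro prod.cong) (auto simp: Suc_diff_le mult.commute)
  thus ?case using Suc by (simp add: mult_ac)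
qed simp

theorem corollary6p3:
  fixes n :: nat
  shows "hankel_det n (\<lambda>k. (2 * real k + 3) * bernoulli (2 * k + 2)) =
    1 / 2 ^ (n + 1) *
    (\<Prod>l = 1..n. (real l ^ 3 * (real l + 1) ^ 3 / (4 * (2 * real l + 1) ^ 2)) ^ (n + 1 - l))"
proof -
  \<comment> \<open>The determinant of this Gram matrix is computed twice: by congruence with the
    Hankel matrix, and by the LDL^T factorization.\<close>
  let ?G = "mat (n + 1) (n + 1) (\<lambda>(i, j). moment bernoulli_seq (node_poly i * node_poly j))"
  have "det ?G = det (mat (n + 1) (n + 1) (\<lambda>(i, j).
      \<Sum>k<n + 1. \<Sum>l<n + 1. coeff (node_poly i) k * bernoulli_seq (k + l) * coeff (node_poly j) l))"
    by (intro arg_cong[of _ _ det] eq_matI)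
      (auto simp: moment_mult[of _ n] degree_node_poly lessThan_Suc_atMost simp del: sum.lessThan_Suc)
  also have "\<dots> = (\<Prod>k<n + 1. coeff (node_poly k) k)\<^sup>2 *
      det (mat (n + 1) (n + 1) (\<lambda>(i, j). bernoulli_seq (i + j)))"
    by (rule det_lower_congruence) (simp add: coeff_eq_0 degree_node_poly)
  \<comment> \<open>The leading coefficients are signs, and their product is squared.\<close>
  also have "(\<Prod>k<n + 1. coeff (node_poly k) k)\<^sup>2 = 1"
    by (simp only: lead_coeff_node_poly prod_power_distrib power_mult[symmetric])
      (simp add: power_mult mult.commute[of _ 2])
  finally have hankel: "det ?G = hankel_det n bernoulli_seq"
    by (simp add: hankel_det_def)
  have "moment bernoulli_seq (node_poly i * node_poly j) =
      (\<Sum>k<n + 1. \<Sum>l<n + 1. ldl_coeff i k * (if k = l then 2 * real k + 2 else 0) * ldl_coeff j l)"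
    if "i < n + 1" "j < n + 1" for i j
  proof -
    have "(\<Sum>l<n + 1. ldl_coeff i k * (if k = l then 2 * real k + 2 else 0) * ldl_coeff j l) =
        ldl_coeff i k * (2 * real k + 2) * ldl_coeff j k" if "k < n + 1" for k
      using that by (subst sum.remove[of _ k]) auto
    hence "(\<Sum>k<n + 1. \<Sum>l<n + 1. ldl_coeff i k * (if k = l then 2 * real k + 2 else 0) * ldl_coeff j l) =
        (\<Sum>k<n + 1. ldl_coeff i k * (2 * real k + 2) * ldl_coeff j k)"
      by (intro sum.cong) auto
    thus ?thesis by (simp only: moment_node_poly_mult ldl_coeff_sum[OF that])
  qed
  hence "det ?G = det (mat (n + 1) (n + 1) (\<lambda>(i, j).
      \<Sum>k<n + 1. \<Sum>l<n + 1. ldl_coeff i k * (if k = l then 2 * real k + 2 else 0) * ldl_coeff j l))"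
    by (intro arg_cong[of _ _ det] eq_matI) auto
  also have "\<dots> = (\<Prod>k<n + 1. ldl_coeff k k)\<^sup>2 * (\<Prod>k<n + 1. 2 * real k + 2)"
    by (subst det_lower_congruence) (simp_all only: det_diagonal, simp add: ldl_coeff_def)
  \<comment> \<open>L is not unit triangular, so its squared diagonal entries are absorbed into the
    pivots.\<close>
  also have "\<dots> = (\<Prod>k<Suc n. (2 * real k + 2) * (ldl_coeff k k)\<^sup>2)"
    by (simp add: prod.distrib prod_power_distrib mult_ac del: prod.lessThan_Suc)
  also have "\<dots> = (1 / 2) ^ (n + 1) *
      (\<Prod>l = 1..n. (real l ^ 3 * (real l + 1) ^ 3 / (4 * (2 * real l + 1) ^ 2)) ^ (n + 1 - l))"
    unfolding ldl_coeff_diag prod.distrib prod_power_staircase by simp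
  finally show ?thesis
    using hankel by (simp add: bernoulli_seq_def[abs_def] power_one_over)
qed

end
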